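(* Let $n\ge2$ and let $G=(V,E)$ be an undirected graph (self-loops allowed) with $V=\{1,\dots,n\}$. Let $t<n$ be a nonnegative integer such that $|E|<\frac12(t^2+3t)=\binom{t+2}{2}-1$. Then $\mathcal P(\mathcal S^n_{r+})$ is closed for all $r=t,t+1,\dots,n$ if and only if $\mathcal L$ and $\mathcal L^c$ are disconnected.
   Context: $\mathcal S^n$ is the space of real symmetric $n\times n$ matrices and $\mathcal S^n_{r+}\subseteq\mathcal S^n$ is the set of positive semidefinite matrices of rank at most $r$. The graph $G=(V,E)$ has index set $E\subseteq\{ij: 1\le i\le j\le n\}$, where $ii\in E$ means that vertex $i$ has a self-loop; $|E|$ counts self-loops as well. $\mathcal P:\mathcal S^n\to\mathbb R^E$ is the coordinate projection $\mathcal P(X)=(X_{ij})_{ij\in E}$, and $\mathcal P(\mathcal S^n_{r+})$ is the image of $\mathcal S^n_{r+}$; closedness is in the Euclidean space $\mathbb R^E$. $\mathcal L=\{i: ii\in E\}$ and $\mathcal L^c=V\setminus\mathcal L$. "$\mathcal L$ and $\mathcal L^c$ are disconnected" means that no edge of $E$ joins a vertex of $\mathcal L$ to a vertex of $\mathcal L^c$. *)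

theory Defs
  imports "HOL-Analysis.Analysis"
begin

text \<open>
  The vertex set \<open>{1, \<dots>, n}\<close> is rendered by a finite linearly ordered type \<open>'n\<close> with
  \<open>n = CARD('n)\<close>. An edge \<open>ij\<close> is the pair \<open>(i, j)\<close> with \<open>i \<le> j\<close>, so that every undirected edge
  has exactly one representative; \<open>(i, i)\<close> is the self-loop at \<open>i\<close>.
\<close>

definition edge_set :: "('n::linorder \<times> 'n) set \<Rightarrow> bool" where
  "edge_set E \<longleftrightarrow> E \<subseteq> {(i, j). i \<le> j}"

definition sym_mats :: "(real ^ 'n ^ 'n) set" where
  "sym_mats = {X. transpose X = X}"

definition psd :: "real ^ 'n ^ 'n \<Rightarrow> bool" where
  "psd X \<longleftrightarrow> X \<in> sym_mats \<and> (\<forall>v. 0 \<le> v \<bullet> (X *v v))"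

definition psd_rank_le :: "nat \<Rightarrow> (real ^ 'n ^ 'n) set" where
  "psd_rank_le r = {X. psd X \<and> rank X \<le> r}"

text \<open>
  \<open>\<real>\<^sup>E\<close> is the space of functions \<open>E \<rightarrow> \<real>\<close>, made extensional outside \<open>E\<close>; this is the
  underlying set of the topological space \<open>powertop_real E\<close>, whose (product) topology is the
  Euclidean one since \<open>E\<close> is finite.
\<close>

definition coord_proj :: "('n \<times> 'n) set \<Rightarrow> real ^ 'n ^ 'n \<Rightarrow> ('n \<times> 'n \<Rightarrow> real)" where
  "coord_proj E X = (\<lambda>(i, j)\<in>E. X $ i $ j)"

definition loop_verts :: "('n \<times> 'n) set \<Rightarrow> 'n set" where
  "loop_verts E = {i. (i, i) \<in> E}"

definition disconnected_in :: "('n \<times> 'n) set \<Rightarrow> 'n set \<Rightarrow> 'n set \<Rightarrow> bool" where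
  "disconnected_in E A B \<longleftrightarrow> (\<forall>a\<in>A. \<forall>b\<in>B. (a, b) \<notin> E \<and> (b, a) \<notin> E)"

end

theory Submission
  imports Defs
begin

text \<open>
  The bound on \<open>|E|\<close> removes the rank constraint (Barvinok--Pataki): if \<open>X\<close> is positive
  semidefinite of rank \<open>\<rho> > t\<close>, the symmetric matrices whose kernel contains that of \<open>X\<close> form a
  space of dimension \<open>\<rho>(\<rho> + 1)/2 > |E|\<close>, so one of them, \<open>Z \<noteq> 0\<close>, vanishes on \<open>E\<close>, and moving
  from \<open>X\<close> along \<open>\<plusminus>Z\<close> to the boundary of the cone lowers the rank without changing the
  entries in \<open>E\<close>. For the full cone, let \<open>L\<close> be the set of vertices with loops. If no edge joins
  \<open>L\<close> to its complement, then the \<open>L \<times> L\<close> blocks of completions of a convergent sequence are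
  bounded, hence subconverge, and the other block is completed with a large diagonal. If \<open>ab\<close> is
  an edge with \<open>a \<in> L\<close> and \<open>b \<notin> L\<close>, then the entries \<open>X\<^sub>a\<^sub>a = 1/m\<close>, \<open>X\<^sub>a\<^sub>b = 1\<close> can be completed
  by choosing \<open>X\<^sub>b\<^sub>b = m\<close>, but their limit \<open>X\<^sub>a\<^sub>a = 0\<close>, \<open>X\<^sub>a\<^sub>b = 1\<close> cannot.
\<close>

section \<open>Kernel, entries and closedness of the positive semidefinite cone\<close>

lemma symmetric_matrix_inner:
  fixes A :: "real^'n^'n"
  assumes "transpose A = A"
  shows "v \<bullet> (A *v w) = (A *v v) \<bullet> w"
  by (metis assms dot_lmul_matrix vector_transpose_matrix)

lemma psd_symmetric: "psd A \<Longrightarrow> transpose A = A"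
  by (simp add: psd_def sym_mats_def)

lemma psd_nonneg: "psd A \<Longrightarrow> 0 \<le> v \<bullet> (A *v v)"
  by (simp add: psd_def)

lemma psdI: "transpose A = A \<Longrightarrow> (\<And>v. 0 \<le> v \<bullet> (A *v v)) \<Longrightarrow> psd A"
  by (simp add: psd_def sym_mats_def)

lemma psd_add: "psd A \<Longrightarrow> psd B \<Longrightarrow> psd (A + B)"
  by (simp add: psd_def sym_mats_def matrix_vector_mult_add_rdistrib inner_add_right transpose_def vec_eq_iff)

text \<open>Along \<open>v + s *\<^sub>R (A *v v)\<close> the quadratic form has linear term
  \<open>2 * s\<close> times the squared norm of \<open>A *v v\<close>, so a nonzero
  \<open>A *v v\<close> would make it negative for small negative \<open>s\<close>.\<close>

lemma psd_kernel:
  fixes A :: "real^'n^'n"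
  assumes A: "psd A" and v: "v \<bullet> (A *v v) = 0"
  shows "A *v v = 0"
proof (rule ccontr)
  assume nz: "A *v v \<noteq> 0"
  define w where "w = A *v v"
  define a where "a = w \<bullet> w"
  define c where "c = w \<bullet> (A *v w)"
  have a: "a > 0" and c: "c \<ge> 0"
    using nz psd_nonneg[OF A] by (auto simp: a_def w_def c_def)
  \<comment> \<open>The \<open>+ 1\<close> keeps the denominator positive when \<open>c = 0\<close>,
    and the step is still short enough for the linear term to win.\<close>
  define s where "s = - (a / (c + 1))"
  have vw: "v \<bullet> (A *v w) = a"
    using symmetric_matrix_inner[OF psd_symmetric[OF A]] by (simp add: a_def w_def)
  have "(v + s *\<^sub>R w) \<bullet> (A *v (v + s *\<^sub>R w)) = 2 * s * a + s\<^sup>2 * c"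
    using v vw
    by (simp add: matrix_vector_right_distrib matrix_vector_mult_scaleR inner_add_left inner_add_right
        power2_eq_square c_def flip: w_def) (simp add: a_def inner_commute algebra_simps)
  also have "\<dots> = - (a\<^sup>2 * (c + 2) / (c + 1)\<^sup>2)"
    using c unfolding s_def by (simp add: divide_simps) algebra
  also have "\<dots> < 0"
    using a c by auto
  finally show False
    using psd_nonneg[OF A] by (metis not_less)
qed

text \<open>Evaluate the form at the sum and the difference of two basis vectors. This lets bounded
  diagonal entries control all entries between them.\<close>

lemma psd_entry_bound:
  fixes A :: "real^'n^'n"
  assumes "psd A"
  shows "2 * \<bar>A $ i $ j\<bar> \<le> A $ i $ i + A $ j $ j"
proof -
  have nth: "axis k 1 \<bullet> (A *v axis l 1) = A $ k $ l" for k l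
    by (simp add: inner_axis' matrix_vector_mult_basis column_def)
  have s: "A $ j $ i = A $ i $ j"
    using psd_symmetric[OF assms] by (metis transpose_def vec_lambda_beta)
  have "0 \<le> (axis i 1 + axis j 1) \<bullet> (A *v (axis i 1 + axis j 1))"
       "0 \<le> (axis i 1 - axis j 1) \<bullet> (A *v (axis i 1 - axis j 1))"
    using psd_nonneg[OF assms] by blast+
  then show ?thesis
    by (simp add: matrix_vector_right_distrib matrix_vector_mult_diff_distrib inner_add_left
        inner_add_right inner_diff_left inner_diff_right nth s)
qed

lemma psd_zero_diag:
  fixes A :: "real^'n^'n"
  assumes "psd A" "A $ i $ i = 0"
  shows "A $ i $ j = 0" "A $ j $ i = 0"
proof -
  have "A *v axis i 1 = 0"
    using assms by (intro psd_kernel) (simp_all add: inner_axis' matrix_vector_mult_basis column_def)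
  then show 1: "A $ j $ i = 0"
    by (simp add: matrix_vector_mult_basis column_def vec_eq_iff)
  then show "A $ i $ j = 0"
    using psd_symmetric[OF assms(1)] by (metis transpose_def vec_lambda_beta)
qed

lemma closed_psd: "closed (Collect psd :: (real^'n^'n) set)"
proof -
  \<comment> \<open>In coordinates the cone is an intersection of closed conditions, each continuous
    in the entries of \<open>A\<close>.\<close>
  have "Collect psd = {A :: real^'n^'n. \<forall>i j. A $ i $ j = A $ j $ i} \<inter>
      {A. \<forall>v. 0 \<le> (\<Sum>i\<in>UNIV. v $ i * (\<Sum>j\<in>UNIV. A $ i $ j * v $ j))}"
    by (auto simp: psd_def sym_mats_def inner_vec_def matrix_vector_mult_def transpose_def vec_eq_iff)
  then show ?thesis
    by (auto intro!: closed_Int closed_Collect_all closed_Collect_eq closed_Collect_le continuous_intros)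
qed

section \<open>Transfer of closedness from the coordinate space to matrices\<close>

lemma coord_proj_eq_iff:
  "coord_proj E X = coord_proj E Y \<longleftrightarrow> (\<forall>(i,j)\<in>E. Y $ i $ j = X $ i $ j)"
  by (auto simp: coord_proj_def restrict_def fun_eq_iff)

text \<open>The matrix set is the preimage of the image of \<open>A\<close> under the continuous map
  \<open>coord_proj E\<close>; conversely that image is the preimage of the matrix set under a
  continuous section. \<open>X\<close> ranges over all matrices, since only its entries in
  \<open>E\<close> matter.\<close>

lemma closedin_coord_proj_iff:
  fixes A :: "(real^'n^'n) set"
  shows "closedin (powertop_real E) (coord_proj E ` A) \<longleftrightarrow>
    closed {X. \<exists>Y\<in>A. \<forall>(i,j)\<in>E. Y $ i $ j = X $ i $ j}"
proof -
  \<comment> \<open>The section: extension by zero outside \<open>E\<close>.\<close>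
  define F where "F b = (\<chi> i j. if (i,j) \<in> E then b (i,j) else (0::real))" for b
  have P: "continuous_map euclidean (powertop_real E) (coord_proj E :: real^'n^'n \<Rightarrow> _)"
    unfolding continuous_map_componentwise coord_proj_def
    by (auto intro!: continuous_intros)
  have "continuous_map (powertop_real E) euclidean (\<lambda>b. if k \<in> E then b k else 0 :: real)" for k
    by (cases "k \<in> E") (simp_all add: continuous_map_product_projection[where X = "\<lambda>_. euclideanreal", simplified])
  then have F: "continuous_map (powertop_real E) euclidean F"
    unfolding F_def continuous_map_atin limitin_canonical_iff
    by (intro ballI tendsto_vec_lambda) blast
  show ?thesis
  proof
    assume "closedin (powertop_real E) (coord_proj E ` A)"
    from closedin_continuous_map_preimage[OF P this]
    have "closed {X. coord_proj E X \<in> coord_proj E ` A}"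
      by simp
    also have "{X. coord_proj E X \<in> coord_proj E ` A} = {X. \<exists>Y\<in>A. \<forall>(i,j)\<in>E. Y $ i $ j = X $ i $ j}"
      by (auto simp: image_iff coord_proj_eq_iff)
    finally show "closed {X. \<exists>Y\<in>A. \<forall>(i,j)\<in>E. Y $ i $ j = X $ i $ j}" .
  next
    assume "closed {X. \<exists>Y\<in>A. \<forall>(i,j)\<in>E. Y $ i $ j = X $ i $ j}"
    then have "closedin (powertop_real E)
        {b \<in> topspace (powertop_real E). F b \<in> {X. \<exists>Y\<in>A. \<forall>(i,j)\<in>E. Y $ i $ j = X $ i $ j}}"
      by (intro closedin_continuous_map_preimage[OF F]) simp
    also have "{b \<in> topspace (powertop_real E). F b \<in> {X. \<exists>Y\<in>A. \<forall>(i,j)\<in>E. Y $ i $ j = X $ i $ j}}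
        = coord_proj E ` A"
    proof (intro equalityI subsetI)
      fix b
      assume "b \<in> {b \<in> topspace (powertop_real E). F b \<in> {X. \<exists>Y\<in>A. \<forall>(i,j)\<in>E. Y $ i $ j = X $ i $ j}}"
      then obtain Y where "Y \<in> A" "\<forall>(i,j)\<in>E. Y $ i $ j = F b $ i $ j" "b \<in> extensional E"
        by (auto simp: PiE_def)
      then have "b = coord_proj E Y"
        by (auto simp: coord_proj_def fun_eq_iff extensional_def F_def)
      then show "b \<in> coord_proj E ` A"
        using \<open>Y \<in> A\<close> by blast
    next
      fix b
      assume "b \<in> coord_proj E ` A"
      then show "b \<in> {b \<in> topspace (powertop_real E). F b \<in> {X. \<exists>Y\<in>A. \<forall>(i,j)\<in>E. Y $ i $ j = X $ i $ j}}"
        by (fastforce simp: coord_proj_def F_def)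
    qed
    finally show "closedin (powertop_real E) (coord_proj E ` A)" .
  qed
qed

section \<open>Failure of closedness across an edge leaving the looped vertices\<close>

lemma not_closed_psd_completion:
  fixes E :: "('n::finite \<times> 'n) set"
  assumes "\<not> disconnected_in E (loop_verts E) (- loop_verts E)"
  shows "\<not> closed {X. \<exists>Y\<in>Collect psd. \<forall>(i,j)\<in>E. Y $ i $ j = X $ i $ j}" (is "\<not> closed ?T")
proof
  assume cl: "closed ?T"
  obtain a b where a: "(a,a) \<in> E" and b: "(b,b) \<notin> E" and e: "(a,b) \<in> E \<or> (b,a) \<in> E"
    using assms by (auto simp: disconnected_in_def loop_verts_def)
  have ab: "a \<noteq> b"
    using a b by auto
  define X where "X s = (\<chi> i j. if i = a \<and> j = a then s
      else if i = a \<and> j = b \<or> i = b \<and> j = a then 1 else (0::real))" for s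
  have "X (inverse (real (Suc n))) \<in> ?T" for n
  proof -
    define s where "s = inverse (real (Suc n))"
    have s: "s > 0"
      by (simp add: s_def)
    \<comment> \<open>The rank-one matrix of \<open>u\<close> has entry \<open>s\<close> at
      \<open>(a,a)\<close> and 1 at \<open>(a,b)\<close>; its growing entry \<open>1 / s\<close> at
      \<open>(b,b)\<close> is unconstrained because \<open>b\<close> has no loop.\<close>
    define u :: "real^'n" where "u = (\<chi> i. if i = a then sqrt s else if i = b then 1 / sqrt s else 0)"
    define Y :: "real^'n^'n" where "Y = (\<chi> i j. u $ i * u $ j)"
    have "v \<bullet> (Y *v v) = (u \<bullet> v)\<^sup>2" for v
      by (simp add: Y_def inner_vec_def matrix_vector_mult_def power2_eq_square sum_product
          sum_distrib_left mult_ac)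
    then have "psd Y"
      by (intro psdI) (auto simp: Y_def transpose_def vec_eq_iff mult_ac)
    moreover have "Y $ i $ j = X s $ i $ j" if "(i,j) \<in> E" for i j
      using that b ab s by (auto simp: Y_def X_def u_def)
    ultimately show ?thesis
      by (auto simp: s_def)
  qed
  moreover have "(\<lambda>n. X (inverse (real (Suc n)))) \<longlonglongrightarrow> X 0"
    unfolding X_def using LIMSEQ_inverse_real_of_nat
    by (intro tendsto_vec_lambda) (auto intro: tendsto_const)
  ultimately have "X 0 \<in> ?T"
    by (rule closed_sequentially[OF cl])
  then obtain Y where Y: "psd Y" "\<And>i j. (i,j) \<in> E \<Longrightarrow> Y $ i $ j = X 0 $ i $ j"
    by blast
  have "Y $ a $ a = 0"
    using Y(2)[OF a] by (simp add: X_def)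
  then have "Y $ a $ b = 0" "Y $ b $ a = 0"
    using psd_zero_diag[OF Y(1)] by blast+
  then show False
    using Y(2) e ab by (auto simp: X_def)
qed

section \<open>Closedness for the full cone in the disconnected case\<close>

lemma psd_principal:
  fixes A :: "real^'n^'n"
  assumes "psd A"
  shows "psd (\<chi> i j. if i \<in> L \<and> j \<in> L then A $ i $ j else 0)" (is "psd ?B")
proof (rule psdI)
  show "transpose ?B = ?B"
    using psd_symmetric[OF assms] by (auto simp: transpose_def vec_eq_iff)
  fix v :: "real^'n"
  define w :: "real^'n" where "w = (\<chi> i. if i \<in> L then v $ i else 0)"
  have "v \<bullet> (?B *v v) = w \<bullet> (A *v w)"
    unfolding inner_vec_def matrix_vector_mult_def w_def
    by (intro sum.cong refl) (auto intro: sum.cong)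
  then show "0 \<le> v \<bullet> (?B *v v)"
    using psd_nonneg[OF assms] by simp
qed

text \<open>By symmetry \<open>S\<close> only sees the part \<open>w\<close> of a vector supported
  on \<open>K\<close>. An operator bound \<open>c\<close> for \<open>S\<close> gives a form of size
  at most \<open>c\<close> times the squared norm of \<open>w\<close>, which is what the diagonal
  adds.\<close>

lemma psd_large_diagonal:
  fixes S :: "real^'n^'n"
  assumes "transpose S = S" "\<And>i j. i \<notin> K \<Longrightarrow> S $ i $ j = 0"
  obtains c where "psd (S + (\<chi> i j. if i = j \<and> i \<in> K then c else 0))"
proof -
  obtain c where c: "\<And>v. norm (S *v v) \<le> norm v * c"
    using bounded_linear.bounded[OF matrix_vector_mul_bounded_linear] by blast
  define D where "D = (\<chi> i j. if i = j \<and> i \<in> K then c else (0::real))"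
  show thesis
  proof (rule that[of c], fold D_def, rule psdI)
    show "transpose (S + D) = S + D"
      using assms(1) by (auto simp: transpose_def vec_eq_iff D_def)
    fix v :: "real^'n"
    define w :: "real^'n" where "w = (\<chi> i. if i \<in> K then v $ i else 0)"
    have S0: "S $ i $ j = 0" if "i \<notin> K \<or> j \<notin> K" for i j
      using assms(2)[of i j] assms(2)[of j i] that arg_cong[OF assms(1), of "\<lambda>A. A $ j $ i"]
      by (auto simp: transpose_def)
    have 1: "v \<bullet> (S *v v) = w \<bullet> (S *v w)"
      unfolding inner_vec_def matrix_vector_mult_def w_def
      by (auto intro!: sum.cong simp: S0)
    have "(D *v v) $ i = c * w $ i" for i
      by (simp add: D_def matrix_vector_mult_def w_def if_distrib[where f="\<lambda>x. x * _"] cong: if_cong)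
    then have 2: "v \<bullet> (D *v v) = c * (w \<bullet> w)"
      unfolding inner_vec_def sum_distrib_left by (intro sum.cong) (auto simp: w_def)
    have "\<bar>w \<bullet> (S *v w)\<bar> \<le> norm w * (norm w * c)"
      by (meson Cauchy_Schwarz_ineq2 c mult_left_mono norm_ge_zero order_trans)
    then show "0 \<le> v \<bullet> ((S + D) *v v)"
      by (simp add: matrix_vector_mult_add_rdistrib inner_add_right 1 2 dot_square_norm power2_eq_square mult_ac)
  qed
qed

lemma closed_psd_completion:
  fixes E :: "('n::finite \<times> 'n) set"
  assumes E: "antisym E" and disc: "disconnected_in E (loop_verts E) (- loop_verts E)"
  shows "closed {X. \<exists>Y\<in>Collect psd. \<forall>(i,j)\<in>E. Y $ i $ j = X $ i $ j}" (is "closed ?T")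
  unfolding closed_sequential_limits
proof safe
  define L where "L = loop_verts E"
  fix x :: "nat \<Rightarrow> real^'n^'n" and X
  assume "\<forall>n. x n \<in> ?T" and lim: "x \<longlonglongrightarrow> X"
  then have "\<forall>n. \<exists>Y. psd Y \<and> (\<forall>(i,j)\<in>E. Y $ i $ j = x n $ i $ j)"
    by blast
  then obtain y where "\<forall>n. psd (y n) \<and> (\<forall>(i,j)\<in>E. y n $ i $ j = x n $ i $ j)"
    unfolding choice_iff by (rule exE)
  then have y: "\<And>n. psd (y n)" and yE: "\<And>n i j. (i,j) \<in> E \<Longrightarrow> y n $ i $ j = x n $ i $ j"
    by auto
  \<comment> \<open>Entries of \<open>y n\<close> outside the looped block may diverge, so they are
    discarded before compactness is used.\<close>
  define z where "z n = (\<chi> i j. if i \<in> L \<and> j \<in> L then y n $ i $ j else 0)" for n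
  have z: "psd (z n)" for n
    unfolding z_def by (rule psd_principal[OF y])
  have "bounded (range x)"
    using lim by (simp add: convergent_imp_bounded)
  then obtain B where B: "\<And>n. norm (x n) \<le> B"
    by (auto simp: bounded_iff)
  have xB: "\<bar>x n $ i $ j\<bar> \<le> B" for n i j
  proof -
    have "\<bar>x n $ i $ j\<bar> \<le> norm (x n $ i)" "norm (x n $ i) \<le> norm (x n)"
      by (simp_all add: component_le_norm_cart Finite_Cartesian_Product.norm_nth_le)
    then show ?thesis
      using B[of n] by linarith
  qed
  have B0: "0 \<le> B"
    using B norm_ge_zero order_trans by blast
  \<comment> \<open>In the looped block the diagonal entries belong to \<open>E\<close>, hence agree
    with those of the bounded sequence \<open>x\<close>.\<close>
  have zB: "\<bar>z n $ i $ j\<bar> \<le> B" for n i j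
  proof (cases "i \<in> L \<and> j \<in> L")
    case True
    then have "(i,i) \<in> E" "(j,j) \<in> E"
      by (auto simp: L_def loop_verts_def)
    then have "y n $ i $ i \<le> B" "y n $ j $ j \<le> B"
      using xB yE by (metis abs_le_D1)+
    then show ?thesis
      using psd_entry_bound[OF y, of n i j] True by (simp add: z_def)
  qed (use B0 in \<open>auto simp: z_def\<close>)
  have "norm (z n) \<le> (\<Sum>i\<in>(UNIV::'n set). \<Sum>j\<in>(UNIV::'n set). B)" for n
  proof -
    have "norm (z n) \<le> (\<Sum>i\<in>UNIV. norm (z n $ i))"
      unfolding norm_vec_def by (rule L2_set_le_sum) simp
    also have "\<dots> \<le> (\<Sum>i\<in>UNIV. \<Sum>j\<in>UNIV. \<bar>z n $ i $ j\<bar>)"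
      by (intro sum_mono norm_le_l1_cart)
    also have "\<dots> \<le> (\<Sum>i\<in>(UNIV::'n set). \<Sum>j\<in>(UNIV::'n set). B)"
      by (intro sum_mono zB)
    finally show ?thesis .
  qed
  then have "bounded (range z)"
    by (auto simp: bounded_iff)
  then obtain Z f where f: "strict_mono (f :: nat \<Rightarrow> nat)" and Z: "(z \<circ> f) \<longlonglongrightarrow> Z"
    using bounded_imp_convergent_subsequence by blast
  have psdZ: "psd Z"
    using closed_psd Z z unfolding closed_sequential_limits by (metis comp_apply mem_Collect_eq)
  have lx: "(\<lambda>n. x (f n) $ i $ j) \<longlonglongrightarrow> X $ i $ j" for i j
    using LIMSEQ_subseq_LIMSEQ[OF lim f] by (intro tendsto_vec_nth) (simp add: o_def)
  have lz: "(\<lambda>n. z (f n) $ i $ j) \<longlonglongrightarrow> Z $ i $ j" for i j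
    using Z by (intro tendsto_vec_nth) (simp add: o_def)
  have Z1: "Z $ i $ j = X $ i $ j" if "i \<in> L" "j \<in> L" "(i,j) \<in> E" for i j
    using LIMSEQ_unique[OF lz[of i j]] lx[of i j] that by (simp add: z_def yE)
  have Z0: "Z $ i $ j = 0" if "i \<notin> L \<or> j \<notin> L" for i j
  proof -
    have "(\<lambda>n. z (f n) $ i $ j) = (\<lambda>n. 0)"
      using that by (auto simp: z_def)
    then show ?thesis
      using LIMSEQ_unique[OF lz[of i j], of 0] by simp
  qed
  \<comment> \<open>The prescribed entries between loopless vertices, symmetrised. Its diagonal is
    free, since no loop constrains it.\<close>
  define S :: "real^'n^'n" where "S = (\<chi> i j. if i \<in> L \<or> j \<in> L \<or> i = j then 0
      else if (i,j) \<in> E then X $ i $ j else if (j,i) \<in> E then X $ j $ i else 0)"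
  have asym: "i = j" if "(i,j) \<in> E" "(j,i) \<in> E" for i j
    using E that by (rule antisymD)
  have "transpose S = S"
    by (auto simp: S_def transpose_def vec_eq_iff dest: asym)
  then obtain c where c: "psd (S + (\<chi> i j. if i = j \<and> i \<in> - L then c else 0))"
    by (rule psd_large_diagonal[where K = "- L"]) (auto simp: S_def)
  \<comment> \<open>\<open>Z\<close> and the second summand occupy complementary diagonal blocks.
    The mixed blocks are zero, which is harmless because no edge lies in them.\<close>
  define Y where "Y = Z + (S + (\<chi> i j. if i = j \<and> i \<in> - L then c else 0))"
  have "psd Y"
    unfolding Y_def by (intro psd_add psdZ c)
  moreover have "Y $ i $ j = X $ i $ j" if ij: "(i,j) \<in> E" for i j
  proof -
    have "i \<in> L \<longleftrightarrow> j \<in> L"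
      using disc ij by (auto simp: disconnected_in_def L_def)
    moreover have "i \<noteq> j" if "i \<notin> L"
      using that ij by (auto simp: L_def loop_verts_def)
    ultimately show ?thesis
      using ij by (cases "i \<in> L") (auto simp: Y_def S_def Z1 Z0)
  qed
  ultimately show "\<exists>Y\<in>Collect psd. \<forall>(i,j)\<in>E. Y $ i $ j = X $ i $ j"
    by blast
qed


section \<open>Rank reduction with the entries in \<open>E\<close> fixed\<close>

text \<open>Gaussian elimination: each equation with a nonzero coefficient removes one unknown, so
  with more unknowns than equations one remains free.\<close>

lemma homogeneous_system_nontrivial_solution:
  fixes f :: "'a \<Rightarrow> 'b \<Rightarrow> 'c::field"
  assumes "finite E" "finite S" "card E < card S"
  obtains c where "\<exists>s\<in>S. c s \<noteq> 0" "\<And>e. e \<in> E \<Longrightarrow> (\<Sum>s\<in>S. c s * f e s) = 0"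
proof -
  have "\<exists>c. (\<exists>s\<in>S. c s \<noteq> 0) \<and> (\<forall>e\<in>E. (\<Sum>s\<in>S. c s * f e s) = 0)"
    using assms
  proof (induction E arbitrary: S f rule: finite_induct)
    case empty
    then have "S \<noteq> {}"
      by auto
    then show ?case
      by (intro exI[of _ "\<lambda>_. 1"]) auto
  next
    case (insert e E)
    show ?case
    proof (cases "\<forall>s\<in>S. f e s = 0")
      case True
      have "card E < card S"
        using insert by simp
      from insert.IH[OF insert.prems(1) this, of f] True show ?thesis
        by (auto intro!: sum.neutral)
    next
      case False
      then obtain p where p: "p \<in> S" "f e p \<noteq> 0"
        by blast
      \<comment> \<open>Eliminates the unknown \<open>p\<close> from the other equations by means of
        equation \<open>e\<close>; \<open>r\<close> below is the value of that unknown which solves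
        \<open>e\<close>.\<close>
      define f' where "f' x s = f x s - f x p * f e s / f e p" for x s
      have "finite (S - {p})" "card E < card (S - {p})"
        using insert p by auto
      from insert.IH[OF this, of f'] obtain c where
        c: "\<exists>s\<in>S - {p}. c s \<noteq> 0" "\<And>x. x \<in> E \<Longrightarrow> (\<Sum>s\<in>S - {p}. c s * f' x s) = 0"
        by blast
      define r where "r = - (\<Sum>s\<in>S - {p}. c s * f e s) / f e p"
      have split: "(\<Sum>s\<in>S. (c(p := r)) s * f x s) = r * f x p + (\<Sum>s\<in>S - {p}. c s * f x s)" for x
        using p insert.prems(1) by (simp add: sum.remove)
      have "(\<Sum>s\<in>S. (c(p := r)) s * f e s) = 0"
        unfolding split using p by (simp add: r_def)
      moreover have "(\<Sum>s\<in>S. (c(p := r)) s * f x s) = 0" if "x \<in> E" for x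
      proof -
        have "0 = (\<Sum>s\<in>S - {p}. c s * f x s) - f x p / f e p * (\<Sum>s\<in>S - {p}. c s * f e s)"
          unfolding c(2)[OF that, symmetric] f'_def sum_distrib_left sum_subtractf[symmetric]
          by (intro sum.cong) (auto simp: algebra_simps)
        then show ?thesis
          unfolding split by (simp add: r_def)
      qed
      ultimately show ?thesis
        using c(1) by (intro exI[of _ "c(p := r)"]) auto
    qed
  qed
  then show thesis
    using that by blast
qed

text \<open>Supplies the direction for lowering the rank; the vector \<open>u\<close> witnesses that
  the ray from \<open>X\<close> along \<open>Z\<close> eventually leaves the cone.\<close>

lemma symmetric_matrix_vanishing_on_edges:
  fixes X :: "real^'n^'n" and E :: "('n::finite \<times> 'n) set"
  assumes X: "transpose X = X" and card: "2 * card E < rank X * (rank X + 1)"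
  obtains Z u where "transpose Z = Z" "\<And>v. X *v v = 0 \<Longrightarrow> Z *v v = 0"
    "\<And>i j. (i,j) \<in> E \<Longrightarrow> Z $ i $ j = 0" "u \<bullet> (Z *v u) < 0"
proof -
  define \<rho> where "\<rho> = rank X"
  have sub: "subspace (range ((*v) X))"
    by (intro linear_subspace_image) auto
  obtain B where B: "B \<subseteq> range ((*v) X)" "pairwise orthogonal B" "\<And>x. x \<in> B \<Longrightarrow> norm x = 1"
      "independent B" "card B = \<rho>"
    using orthonormal_basis_subspace[OF sub] unfolding \<rho>_def rank_dim_range by metis
  have "finite B"
    using B(4) by (simp add: finiteI_independent)
  then obtain b where b: "bij_betw b {0..<\<rho>} B"
    using ex_bij_betw_nat_finite B(5) by blast
  have bB: "b i \<in> B" if "i < \<rho>" for i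
    using b that by (auto simp: bij_betw_def)
  have bb: "b i \<bullet> b j = (if i = j then 1 else 0)" if "i < \<rho>" "j < \<rho>" for i j
  proof (cases "i = j")
    case True
    then show ?thesis
      using B(3)[OF bB] that by (simp add: norm_eq_1)
  next
    case False
    then have "b i \<noteq> b j"
      using b that by (auto simp: bij_betw_def inj_on_def)
    then show ?thesis
      using B(2) bB that False by (auto simp: pairwise_def orthogonal_def)
  qed
  have bker: "b i \<bullet> v = 0" if i: "i < \<rho>" and v: "X *v v = 0" for i v
  proof -
    obtain w where "b i = X *v w"
      using B(1) bB[OF i] by auto
    then show ?thesis
      using v symmetric_matrix_inner[OF X, of w v] by simp
  qed
  \<comment> \<open>Triangular indexing takes each unordered pair of basis vectors once, giving
    \<open>\<rho> * (\<rho> + 1) / 2\<close> unknowns.\<close>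
  define S where "S = (SIGMA j:{..<\<rho>}. {..j})"
  have finS: "finite S"
    by (simp add: S_def)
  have "2 * (\<Sum>j<m. Suc j) = m * (m + 1)" for m
    by (induction m) auto
  then have "2 * card S = \<rho> * (\<rho> + 1)"
    by (simp add: S_def)
  then have "card E < card S"
    using card by (simp add: \<rho>_def)
  \<comment> \<open>Symmetrised products of basis vectors of the range of \<open>X\<close>. They
    annihilate the kernel of \<open>X\<close>, which is orthogonal to that range.\<close>
  define F :: "nat \<times> nat \<Rightarrow> real^'n^'n" where
    "F s = (\<chi> k l. b (fst s) $ k * b (snd s) $ l + b (snd s) $ k * b (fst s) $ l)" for s
  obtain c where c: "\<exists>s\<in>S. c s \<noteq> 0" "\<And>e. e \<in> E \<Longrightarrow> (\<Sum>s\<in>S. c s * F s $ fst e $ snd e) = 0"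
    using homogeneous_system_nontrivial_solution[OF _ finS \<open>card E < card S\<close>,
        of "\<lambda>e s. F s $ fst e $ snd e"] by auto
  define Z where "Z = (\<Sum>s\<in>S. c s *\<^sub>R F s)"
  have Zv: "Z *v v = (\<Sum>s\<in>S. c s *\<^sub>R ((b (snd s) \<bullet> v) *\<^sub>R b (fst s) + (b (fst s) \<bullet> v) *\<^sub>R b (snd s)))" for v
  proof -
    have F: "F s *v v = (b (snd s) \<bullet> v) *\<^sub>R b (fst s) + (b (fst s) \<bullet> v) *\<^sub>R b (snd s)" for s
      by (simp add: F_def vec_eq_iff matrix_vector_mult_def inner_vec_def sum_distrib_left
          sum_distrib_right sum.distrib distrib_left distrib_right mult_ac)
    have lin: "linear (\<lambda>A::real^'n^'n. A *v v)"
      by (intro linearI) (auto simp: matrix_vector_mult_add_rdistrib scaleR_matrix_vector_assoc)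
    have "Z *v v = (\<Sum>s\<in>S. c s *\<^sub>R (F s *v v))"
      using linear_sum[OF lin, of "\<lambda>s. c s *\<^sub>R F s" S] linear_scale[OF lin] by (simp add: Z_def)
    then show ?thesis
      by (simp add: F)
  qed
  have Zsym: "transpose Z = Z"
    by (simp add: Z_def F_def transpose_def vec_eq_iff add.commute mult.commute)
  have Zker: "Z *v v = 0" if "X *v v = 0" for v
    unfolding Zv using bker[OF _ that] by (auto intro!: sum.neutral simp: S_def)
  have ZE: "Z $ i $ j = 0" if "(i,j) \<in> E" for i j
    using c(2)[OF that] by (simp add: Z_def)
  obtain i j where ij: "(i,j) \<in> S" "c (i,j) \<noteq> 0"
    using c(1) by auto
  then have lt: "i < \<rho>" "j < \<rho>" "j \<le> i"
    by (auto simp: S_def)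
  \<comment> \<open>Orthonormality and \<open>j \<le> i\<close> isolate one coefficient; the factor
    2 arises because \<open>F (i,i)\<close> counts its product twice.\<close>
  have "b i \<bullet> (Z *v b j) = (\<Sum>s\<in>S. if s = (i,j) then c (i,j) * (if i = j then 2 else 1) else 0)"
    unfolding Zv inner_sum_right
    using lt by (intro sum.cong) (auto simp: S_def inner_add_right bb split: if_splits)
  also have "\<dots> = c (i,j) * (if i = j then 2 else 1)"
    using finS ij by simp
  finally have nz: "b i \<bullet> (Z *v b j) \<noteq> 0"
    using ij by auto
  \<comment> \<open>Polarization: the form of \<open>Z\<close> is nonzero at \<open>b i\<close>,
    \<open>b j\<close> or their sum. If it is positive there, \<open>- Z\<close> is used
    instead.\<close>
  have "(b i + b j) \<bullet> (Z *v (b i + b j)) = b i \<bullet> (Z *v b i) + b j \<bullet> (Z *v b j) + 2 * (b i \<bullet> (Z *v b j))"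
    using symmetric_matrix_inner[OF Zsym, of "b j" "b i"]
    by (simp add: matrix_vector_right_distrib inner_add_left inner_add_right inner_commute)
  then obtain u where u: "u \<bullet> (Z *v u) \<noteq> 0"
    using nz by (metis add_0 mult_eq_0_iff zero_neq_numeral)
  show thesis
  proof (cases "u \<bullet> (Z *v u) < 0")
    case True
    then show ?thesis
      using that[of Z u] Zsym Zker ZE by blast
  next
    case False
    have neg: "(- Z) *v v = - (Z *v v)" for v
      by (simp add: vec_eq_iff matrix_vector_mult_def sum_negf)
    have "transpose (- Z) = - Z"
      using Zsym by (simp add: transpose_def vec_eq_iff)
    then show ?thesis
      using that[of "- Z" u] Zker ZE u False by (simp add: neg)
  qed
qed

text \<open>
  The exit point of the ray \<open>X + s Z\<close> from the cone is found by minimising the quotient of the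
  two quadratic forms on the unit sphere of the range of \<open>X\<close>.
\<close>

lemma psd_rank_decrease:
  fixes X Z :: "real^'n^'n"
  assumes X: "psd X" and Z: "transpose Z = Z" and ker: "\<And>v. X *v v = 0 \<Longrightarrow> Z *v v = 0"
    and u: "u \<bullet> (Z *v u) < 0"
  obtains s where "psd (X + s *\<^sub>R Z)" "rank (X + s *\<^sub>R Z) < rank X"
proof -
  define R where "R = range ((*v) X)"
  have sub: "subspace R"
    unfolding R_def by (intro linear_subspace_image) auto
  note symX = symmetric_matrix_inner[OF psd_symmetric[OF X]] and symZ = symmetric_matrix_inner[OF Z]
  \<comment> \<open>Since \<open>X\<close> is symmetric, the orthogonal complement of its range is
    its kernel.\<close>
  have dec: "\<exists>r\<in>R. \<exists>k. v = r + k \<and> X *v k = 0" for v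
  proof -
    obtain r k where rk: "r \<in> span R" "\<And>w. w \<in> span R \<Longrightarrow> orthogonal k w" "v = r + k"
      using orthogonal_subspace_decomp_exists by blast
    have "X *v (X *v k) \<in> span R"
      by (auto simp: R_def intro: span_base)
    then have "(X *v k) \<bullet> (X *v k) = 0"
      using rk(2) symX[of k "X *v k"] by (simp add: orthogonal_def)
    then show ?thesis
      using rk sub by (metis inner_eq_zero_iff span_eq_iff)
  qed
  have form: "(r + k) \<bullet> (A *v (r + k)) = r \<bullet> (A *v r)" if "transpose A = A" "A *v k = 0" for A :: "real^'n^'n" and r k
    using that symmetric_matrix_inner[OF that(1), of k r]
    by (simp add: matrix_vector_right_distrib inner_add_left)
  have pos: "v \<bullet> (X *v v) > 0" if "v \<in> R" "v \<noteq> 0" for v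
  proof (rule ccontr)
    assume "\<not> v \<bullet> (X *v v) > 0"
    then have "X *v v = 0"
      using psd_nonneg[OF X, of v] by (intro psd_kernel[OF X]) auto
    moreover obtain w where "v = X *v w"
      using \<open>v \<in> R\<close> by (auto simp: R_def)
    ultimately have "v \<bullet> v = 0"
      using symX[of w v] by simp
    then show False
      using that by simp
  qed
  \<comment> \<open>\<open>q\<close> is invariant under nonzero scaling, so its minimum on the
    compact set \<open>C\<close> is its minimum on all nonzero vectors of \<open>R\<close>.\<close>
  define q where "q v = (v \<bullet> (Z *v v)) / (v \<bullet> (X *v v))" for v
  have q_scale: "q (a *\<^sub>R v) = q v" if "a \<noteq> 0" for a v
    using that by (simp add: q_def matrix_vector_mult_scaleR)
  obtain r k where r: "r \<in> R" "u = r + k" "X *v k = 0"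
    using dec by blast
  have rneg: "r \<bullet> (Z *v r) < 0"
    using u form[OF Z ker[OF r(3)]] r(2) by simp
  then have "r \<noteq> 0"
    by auto
  have qr: "q r < 0"
    unfolding q_def using rneg pos[OF r(1) \<open>r \<noteq> 0\<close>] by (simp add: divide_neg_pos)
  define C where "C = R \<inter> sphere 0 1"
  have normalise: "v /\<^sub>R norm v \<in> C" "q (v /\<^sub>R norm v) = q v" if "v \<in> R" "v \<noteq> 0" for v
    using that sub q_scale by (auto simp: C_def subspace_scale)
  have "compact C"
    unfolding C_def using closed_subspace[OF sub] by (intro closed_Int_compact) auto
  moreover have "C \<noteq> {}"
    using normalise(1)[OF r(1) \<open>r \<noteq> 0\<close>] by blast
  moreover have "continuous_on C q"
  proof -
    have "v \<bullet> (X *v v) \<noteq> 0" if "v \<in> C" for v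
      using pos[of v] that by (force simp: C_def)
    then show ?thesis
      unfolding q_def by (intro continuous_intros linear_continuous_on matrix_vector_mul_bounded_linear) auto
  qed
  ultimately obtain v0 where v0: "v0 \<in> C" "\<And>v. v \<in> C \<Longrightarrow> q v0 \<le> q v"
    using continuous_attains_inf by metis
  have v0R: "v0 \<in> R" "v0 \<noteq> 0"
    using v0(1) by (auto simp: C_def)
  have qmin: "q v0 \<le> q v" if "v \<in> R" "v \<noteq> 0" for v
    using v0(2) normalise that by metis
  have q0: "q v0 < 0"
    using qmin[OF r(1) \<open>r \<noteq> 0\<close>] qr by linarith
  \<comment> \<open>Then \<open>1 + s * q v\<close> is nonnegative for nonzero \<open>v\<close> in
    \<open>R\<close> and vanishes at \<open>v0\<close>.\<close>
  define s where "s = - 1 / q v0"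
  define Y where "Y = X + s *\<^sub>R Z"
  have s: "s > 0"
    using q0 by (simp add: s_def divide_neg_neg)
  have Yv: "Y *v v = X *v v + s *\<^sub>R (Z *v v)" for v
    by (simp add: Y_def matrix_vector_mult_add_rdistrib scaleR_matrix_vector_assoc)
  have Ysym: "transpose Y = Y"
    using psd_symmetric[OF X] Z by (simp add: Y_def transpose_def vec_eq_iff)
  have Yform: "v \<bullet> (Y *v v) = (v \<bullet> (X *v v)) * (1 + s * q v)" if "v \<in> R" "v \<noteq> 0" for v
    using pos[OF that] by (simp add: Yv q_def inner_add_right field_simps)
  have psdY: "psd Y"
  proof (rule psdI[OF Ysym])
    fix v
    obtain r k where rk: "r \<in> R" "v = r + k" "X *v k = 0"
      using dec by blast
    have "Y *v k = 0"
      using rk(3) ker by (simp add: Yv)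
    then have eq: "v \<bullet> (Y *v v) = r \<bullet> (Y *v r)"
      using form[OF Ysym] rk(2) by simp
    show "0 \<le> v \<bullet> (Y *v v)"
    proof (cases "r = 0")
      case False
      have "s * q v0 \<le> s * q r"
        using qmin[OF rk(1) False] s by simp
      moreover have "s * q v0 = - 1"
        using q0 by (simp add: s_def)
      ultimately show ?thesis
        unfolding eq Yform[OF rk(1) False] using pos[OF rk(1) False] by simp
    qed (simp add: eq)
  qed
  have Yv0: "Y *v v0 = 0"
    using Yform[OF v0R] q0 by (intro psd_kernel[OF psdY]) (simp add: s_def)
  \<comment> \<open>The kernel component \<open>k\<close> of \<open>Y *v w\<close> lies in the
    kernel of \<open>Y\<close>, hence is orthogonal both to \<open>Y *v w\<close> and to
    \<open>r\<close>. The inclusion is strict because \<open>v0\<close> in \<open>R\<close> is a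
    nonzero kernel vector of \<open>Y\<close>, orthogonal to its range.\<close>
  have "range ((*v) Y) \<subseteq> R"
  proof safe
    fix w
    obtain r k where rk: "r \<in> R" "Y *v w = r + k" "X *v k = 0"
      using dec by blast
    have "k \<bullet> (Y *v w) = 0"
      using rk(3) ker symmetric_matrix_inner[OF Ysym, of k w] by (simp add: Yv)
    moreover have "k \<bullet> r = 0"
      using rk(1,3) symX[of k] by (auto simp: R_def)
    ultimately have "k = 0"
      by (simp add: rk(2) inner_add_right)
    then show "Y *v w \<in> R"
      using rk by simp
  qed
  moreover have "v0 \<notin> range ((*v) Y)"
  proof safe
    fix w
    assume "v0 = Y *v w"
    then have "v0 \<bullet> v0 = 0"
      using symmetric_matrix_inner[OF Ysym, of v0 w] Yv0 by simp
    then show False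
      using v0R by simp
  qed
  ultimately have "range ((*v) Y) \<subset> R"
    using v0R by blast
  moreover have "subspace (range ((*v) Y))"
    by (intro linear_subspace_image) auto
  ultimately have "rank Y < rank X"
    using sub unfolding rank_dim_range R_def by (metis dim_psubset span_eq_iff)
  then show thesis
    using that psdY by (simp add: Y_def)
qed

lemma psd_completion_low_rank:
  fixes X :: "real^'n^'n" and E :: "('n::finite \<times> 'n) set"
  assumes "psd X" and card: "2 * card E < (t + 1) * (t + 2)"
  shows "\<exists>Y. psd Y \<and> rank Y \<le> t \<and> (\<forall>(i,j)\<in>E. Y $ i $ j = X $ i $ j)"
  using assms(1)
proof (induction "rank X" arbitrary: X rule: less_induct)
  case less
  show ?case
  proof (cases "rank X \<le> t")
    case True
    then show ?thesis
      using less.prems by blast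
  next
    case False
    then have "(t + 1) * (t + 2) \<le> rank X * (rank X + 1)"
      by (intro mult_mono) auto
    then have "2 * card E < rank X * (rank X + 1)"
      using card by simp
    then obtain Z u where Z: "transpose Z = Z" "\<And>v. X *v v = 0 \<Longrightarrow> Z *v v = 0"
      "\<And>i j. (i,j) \<in> E \<Longrightarrow> Z $ i $ j = 0" "u \<bullet> (Z *v u) < 0"
      using symmetric_matrix_vanishing_on_edges[OF psd_symmetric[OF less.prems]] by metis
    obtain s where s: "psd (X + s *\<^sub>R Z)" "rank (X + s *\<^sub>R Z) < rank X"
      using psd_rank_decrease[OF less.prems Z(1,2,4)] by blast
    obtain Y where "psd Y" "rank Y \<le> t" "\<forall>(i,j)\<in>E. Y $ i $ j = (X + s *\<^sub>R Z) $ i $ j"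
      using less.hyps[OF s(2,1)] by blast
    then show ?thesis
      using Z(3) by fastforce
  qed
qed

section \<open>Reduction of every admissible rank bound to the full cone\<close>

theorem corollary1p2:
  fixes E :: "('n::{finite,linorder} \<times> 'n) set" and t :: nat
  assumes "CARD('n) \<ge> 2"
    and "edge_set E"
    and "t < CARD('n)"
    and "real (card E) < 1 / 2 * (real t ^ 2 + 3 * real t)"
  shows "(\<forall>r\<in>{t..CARD('n)}.
            closedin (powertop_real E)
              (coord_proj E ` psd_rank_le r))
         \<longleftrightarrow> disconnected_in E (loop_verts E) (- loop_verts E)"
proof -
  have "real (2 * card E) < real (t ^ 2 + 3 * t)"
    using assms(4) by simp
  then have card: "2 * card E < (t + 1) * (t + 2)"
    unfolding of_nat_less_iff by (simp add: power2_eq_square)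
  have "{X. \<exists>Y\<in>psd_rank_le r. \<forall>(i,j)\<in>E. Y $ i $ j = X $ i $ j}
      = {X. \<exists>Y\<in>Collect psd. \<forall>(i,j)\<in>E. Y $ i $ j = X $ i $ j}" (is "?A = ?B") if "t \<le> r" for r
  proof
    show "?A \<subseteq> ?B"
      by (auto simp: psd_rank_le_def)
    show "?B \<subseteq> ?A"
    proof
      fix X
      assume "X \<in> ?B"
      then obtain Y where Y: "psd Y" "\<forall>(i,j)\<in>E. Y $ i $ j = X $ i $ j"
        by blast
      obtain W where W: "psd W" "rank W \<le> t" "\<forall>(i,j)\<in>E. W $ i $ j = Y $ i $ j"
        using psd_completion_low_rank[OF Y(1) card] by blast
      then have "W \<in> psd_rank_le r" "\<forall>(i,j)\<in>E. W $ i $ j = X $ i $ j"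
        using that Y(2) by (simp add: psd_rank_le_def, fastforce)
      then show "X \<in> ?A"
        by blast
    qed
  qed
  then have closed_iff: "closedin (powertop_real E) (coord_proj E ` psd_rank_le r) \<longleftrightarrow>
      closed {X. \<exists>Y\<in>Collect psd. \<forall>(i,j)\<in>E. Y $ i $ j = X $ i $ j}" if "t \<le> r" for r
    using that by (simp only: closedin_coord_proj_iff)
  have "i \<le> j" if "(i,j) \<in> E" for i j
    using assms(2) that by (auto simp: edge_set_def)
  then have "antisym E"
    by (intro antisymI order.antisym)
  then have "closed {X. \<exists>Y\<in>Collect psd. \<forall>(i,j)\<in>E. Y $ i $ j = X $ i $ j} \<longleftrightarrow>
      disconnected_in E (loop_verts E) (- loop_verts E)"
    using closed_psd_completion not_closed_psd_completion by blast
  \<comment> \<open>The range of \<open>r\<close> is nonempty, so closedness for all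
    \<open>r\<close> does yield closedness for the full cone.\<close>
  moreover have "t \<in> {t..CARD('n)}"
    using assms(3) by simp
  ultimately show ?thesis
    using closed_iff by (meson atLeastAtMost_iff)
qed

end
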